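(* Let $r \geq 4$ be an integer and let $M_r$ be the $2^r \times 2^r$ real symmetric matrix whose rows and columns are indexed by the subsets of $[r]=\{1,\ldots,r\}$, with entries \[ M_r(S,T) = \binom{|S\cap T|}{2} + \binom{|\overline{S}\cap\overline{T}|}{2}, \] where $\overline{S} = [r]\setminus S$. Then the eigenvalues of $M_r$ are exactly $0$, $2^{r-3}(r-2)$, $2^{r-3}$, $2^{r-4}(r^2-r+2)$ and $2^{r-2}(r-1)$, with multiplicities $2^r - \binom{r+1}{2}$, $r-1$, $\binom{r}{2}-1$, $1$ and $1$, respectively.
   Context: $\binom{n}{2} = n(n-1)/2$ for nonnegative integers $n$ (so it is $0$ for $n<2$). *)

theory Defs
  imports
    Jordan_Normal_Form.Matrix
    Jordan_Normal_Form.Char_Poly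
    Jordan_Normal_Form.Spectral_Radius
begin

definition M_entry :: "nat \<Rightarrow> nat set \<Rightarrow> nat set \<Rightarrow> real" where
  "M_entry r S T =
     real (card (S \<inter> T) choose 2) + real (card (({1..r} - S) \<inter> ({1..r} - T)) choose 2)"

(* Matrices in this library have rows and columns numbered 0, 1, ..., so the indexing by subsets
   goes through an enumeration e, which is meant to map {0..<2^r} bijectively onto Pow {1..r}. *)
definition M_mat :: "nat \<Rightarrow> (nat \<Rightarrow> nat set) \<Rightarrow> real mat" where
  "M_mat r e = mat (2 ^ r) (2 ^ r) (\<lambda>(i, j). M_entry r (e i) (e j))"

(* Algebraic multiplicity; for a real symmetric matrix it equals the dimension of the eigenspace. *)
definition eigenvalue_mult :: "real mat \<Rightarrow> real \<Rightarrow> nat" where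
  "eigenvalue_mult A c = Polynomial.order c (char_poly A)"

end

theory Submission
  imports Defs
begin

text \<open>
  With \<open>x\<close>, \<open>y\<close> the sign vectors of \<open>S\<close>, \<open>T\<close> and \<open>N = r choose 2\<close>, expanding the two binomial
  coefficients shows that \<open>8 M(S, T)\<close> equals
  \<open>N + e2(x) + e2(y) + (r - 2) (x \<bullet> y) + e1(x) e1(y) + (\<Sum>i<j. x_i x_j y_i y_j)\<close>,
  so \<open>M\<close> only involves the Walsh characters of degree at most 2. By orthogonality of the characters,
  up to the factor \<open>2^(r - 3)\<close>, \<open>M\<close> acts as \<open>(r - 2) I + J\<close> on degree 1, has rank one with eigenvalue
  \<open>N + 1\<close> on the span of \<open>1\<close> and \<open>e2\<close>, is the identity on differences of degree 2 characters, and
  kills degree at least 3. An explicit eigenbasis indexed by \<open>Pow {1..r}\<close> splits the characteristic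
  polynomial into linear factors, and the multiplicities are obtained by counting subsets.
\<close>

declare One_nat_def [simp del]

section \<open>Linear algebra: multiplicities from an eigenbasis\<close>

text \<open>The rows of \<open>B\<close> are left eigenvectors of \<open>A\<close>. A trivial kernel
  makes \<open>B\<close> invertible, with inverse \<open>C\<close>, so \<open>A = C * D * B\<close>
  is similar to the diagonal matrix \<open>D\<close>. Asking only for a trivial kernel means that no
  inverse has to be exhibited.\<close>

lemma char_poly_diagonalized:
  fixes A B :: "'a :: field mat"
  assumes A: "A \<in> carrier_mat n n" and B: "B \<in> carrier_mat n n"
    and eig: "\<And>i j. i < n \<Longrightarrow> j < n \<Longrightarrow> (B * A) $$ (i, j) = d i * B $$ (i, j)"
    and inj: "\<And>v. v \<in> carrier_vec n \<Longrightarrow> B *\<^sub>v v = 0\<^sub>v n \<Longrightarrow> v = 0\<^sub>v n"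
  shows "char_poly A = (\<Prod>i<n. [:- d i, 1:])"
proof -
  define D where "D = mat n n (\<lambda>(i, j). if i = j then d i else 0)"
  have D: "D \<in> carrier_mat n n" by (simp add: D_def)
  have "det B \<noteq> 0"
    using det_0_iff_vec_prod_zero[OF B] inj by auto
  from det_non_zero_imp_unit[OF B this, of "()"]
  obtain C where C: "C \<in> carrier_mat n n" and CB: "C * B = 1\<^sub>m n" and BC: "B * C = 1\<^sub>m n"
    by (auto simp: Units_def ring_mat_def)
  have "B * A = D * B"
  proof (rule eq_matI)
    fix i j assume "i < dim_row (D * B)" "j < dim_col (D * B)"
    hence ij: "i < n" "j < n" using D B by auto
    have "(D * B) $$ (i, j) = (\<Sum>k<n. (if i = k then d i else 0) * B $$ (k, j))"
      using ij B by (simp add: D_def scalar_prod_def lessThan_atLeast0)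
    also have "\<dots> = d i * B $$ (i, j)"
      using ij by (simp add: if_distrib[of "\<lambda>x. x * _"] cong: if_cong)
    finally show "(B * A) $$ (i, j) = (D * B) $$ (i, j)" using eig[OF ij] by simp
  qed (use A B D in auto)
  hence "C * B * A = C * D * B"
    using A B C D by (simp add: assoc_mult_mat[where ?n\<^sub>1.0 = n and ?n\<^sub>2.0 = n and ?n\<^sub>3.0 = n and ?n\<^sub>4.0 = n])
  hence "A = C * D * B"
    using A CB by simp
  hence "similar_mat A D"
    using A B C D CB BC by (intro similar_matI[of _ _ C B n]) auto
  hence "char_poly A = char_poly D" by (rule char_poly_similar)
  also have "\<dots> = (\<Prod>a\<leftarrow>diag_mat D. [:- a, 1:])"
    by (rule char_poly_upper_triangular[OF D]) (auto simp: D_def)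
  also have "diag_mat D = map d [0..<n]"
    by (auto simp: diag_mat_def D_def)
  also have "(\<Prod>a\<leftarrow>map d [0..<n]. [:- a, 1:]) = (\<Prod>i<n. [:- d i, 1:])"
    by (simp add: interv_sum_list_conv_sum_set_nat prod.list_conv_set_nth lessThan_atLeast0)
  finally show ?thesis .
qed

text \<open>Turns an algebraic multiplicity into a count of labels.\<close>

lemma order_prod_linear:
  fixes d :: "'b \<Rightarrow> 'a :: idom"
  assumes "finite I"
  shows "Polynomial.order c (\<Prod>i\<in>I. [:- d i, 1:]) = card {i \<in> I. d i = c}"
  using assms
proof (induction I)
  case (insert i I)
  have nz: "[:- d i, 1:] * (\<Prod>i\<in>I. [:- d i, 1:]) \<noteq> 0"
    using insert by (intro no_zero_divisors) auto
  have "Polynomial.order c [:- d i, 1:] = (if d i = c then 1 else 0)"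
    using order_power_n_n[of c 1] by (auto intro: order_0I)
  moreover have "{k \<in> insert i I. d k = c} =
      (if d i = c then insert i {k \<in> I. d k = c} else {k \<in> I. d k = c})"
    by auto
  ultimately show ?case
    using insert nz by (simp add: order_mult del: mult_pCons_left)
qed simp

section \<open>Sums over subsets of size at most two\<close>

definition pairs :: "'a set \<Rightarrow> 'a set set" where
  "pairs A = {W. W \<subseteq> A \<and> card W = 2}"

lemma finite_pairs [simp]: "finite A \<Longrightarrow> finite (pairs A)"
  by (simp add: pairs_def)

lemma card_pairs: "finite A \<Longrightarrow> card (pairs A) = card A choose 2"
  by (simp add: pairs_def n_subsets)

text \<open>Each cross term occurs twice in the square but once among the two-element subsets;
  adjoining \<open>a\<close> creates exactly the pairs \<open>{a, i}\<close>. For signs the squares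
  are 1, so this trades the square of a degree 1 sum for a degree 2 sum.\<close>

lemma square_sum_pairs:
  fixes z :: "'a \<Rightarrow> 'b :: comm_ring_1"
  assumes "finite A"
  shows "(\<Sum>i\<in>A. z i)\<^sup>2 = (\<Sum>i\<in>A. (z i)\<^sup>2) + 2 * (\<Sum>W\<in>pairs A. \<Prod>i\<in>W. z i)"
  using assms
proof (induction A)
  case empty
  have "pairs {} = ({} :: 'a set set)" by (auto simp: pairs_def)
  thus ?case by simp
next
  case (insert a A)
  have split: "pairs (insert a A) = pairs A \<union> (\<lambda>i. {a, i}) ` A"
  proof (intro equalityI subsetI)
    fix W assume "W \<in> pairs (insert a A)"
    thus "W \<in> pairs A \<union> (\<lambda>i. {a, i}) ` A"
      by (auto simp: pairs_def card_2_iff)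
  next
    fix W assume "W \<in> pairs A \<union> (\<lambda>i. {a, i}) ` A"
    thus "W \<in> pairs (insert a A)"
      using insert by (auto simp: pairs_def card_2_iff)
  qed
  have inj: "inj_on (\<lambda>i. {a, i}) A"
    by (auto simp: inj_on_def doubleton_eq_iff)
  have disj: "pairs A \<inter> (\<lambda>i. {a, i}) ` A = {}"
    using insert by (auto simp: pairs_def)
  have "(\<Sum>W\<in>pairs (insert a A). \<Prod>i\<in>W. z i)
      = (\<Sum>W\<in>pairs A. \<Prod>i\<in>W. z i) + (\<Sum>i\<in>A. \<Prod>k\<in>{a, i}. z k)"
    unfolding split using insert disj inj
    by (subst sum.union_disjoint) (auto simp: sum.reindex)
  also have "(\<Sum>i\<in>A. \<Prod>k\<in>{a, i}. z k) = (\<Sum>i\<in>A. z a * z i)"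
  proof (rule sum.cong)
    fix i assume "i \<in> A"
    hence "a \<noteq> i" using insert by auto
    thus "(\<Prod>k\<in>{a, i}. z k) = z a * z i" by simp
  qed simp
  finally show ?case
    using insert by (simp add: power2_sum algebra_simps flip: sum_distrib_left sum_distrib_right)
qed

lemma sum_Pow_card_le_2:
  assumes "finite A" and "\<And>U. U \<subseteq> A \<Longrightarrow> card U > 2 \<Longrightarrow> f U = 0"
  shows "(\<Sum>U\<in>Pow A. f U) = f {} + (\<Sum>i\<in>A. f {i}) + (\<Sum>W\<in>pairs A. f W)"
proof -
  let ?S = "(\<lambda>i. {i}) ` A"
  have fin: "finite U" if "U \<subseteq> A" for U using that assms(1) finite_subset by blast
  have "(\<Sum>U\<in>Pow A. f U) = (\<Sum>U\<in>insert {} (?S \<union> pairs A). f U)"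
  proof (rule sum.mono_neutral_right)
    show "\<forall>U\<in>Pow A - insert {} (?S \<union> pairs A). f U = 0"
    proof
      fix U assume U: "U \<in> Pow A - insert {} (?S \<union> pairs A)"
      hence "card U \<noteq> 0" "card U \<noteq> 1" "card U \<noteq> 2"
        using fin by (auto simp: pairs_def elim!: card_1_singletonE)
      hence "card U > 2" by linarith
      thus "f U = 0" using U assms(2) by auto
    qed
  qed (use assms(1) in \<open>auto simp: pairs_def\<close>)
  also have "\<dots> = f {} + (\<Sum>U\<in>?S \<union> pairs A. f U)"
    using assms(1) by (subst sum.insert) (auto simp: pairs_def)
  also have "(\<Sum>U\<in>?S \<union> pairs A. f U) = (\<Sum>U\<in>?S. f U) + (\<Sum>W\<in>pairs A. f W)"
    using assms(1) by (subst sum.union_disjoint) (auto simp: pairs_def)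
  also have "(\<Sum>U\<in>?S. f U) = (\<Sum>i\<in>A. f {i})"
    by (subst sum.reindex) auto
  finally show ?thesis by (simp add: add.assoc)
qed

section \<open>Walsh characters: orthogonality and completeness\<close>

text \<open>For finite \<open>U\<close> this is the character
  \<open>(-1) ^ card (U \<inter> S)\<close>, the monomial indexed by \<open>U\<close> in the sign
  vector of \<open>S\<close>.\<close>

definition walsh :: "'a set \<Rightarrow> 'a set \<Rightarrow> real" where
  "walsh U S = (\<Prod>i\<in>U. if i \<in> S then - 1 else 1)"

lemma walsh_empty [simp]: "walsh {} S = 1"
  by (simp add: walsh_def)

lemma walsh_singleton: "walsh {i} S = (if i \<in> S then - 1 else 1)"
  by (simp add: walsh_def)

lemma walsh_singleton_square [simp]: "walsh {i} S * walsh {i} S = 1"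
  by (simp add: walsh_singleton)

lemma walsh_eq_prod: "walsh U S = (\<Prod>i\<in>U. walsh {i} S)"
  by (simp add: walsh_def walsh_singleton)

lemma walsh_commute:
  assumes "finite U" "finite S"
  shows "walsh U S = walsh S U"
proof -
  have "walsh U S = (- 1) ^ card (U \<inter> S)" if "finite U" for U S :: "'a set"
    using that by (simp add: walsh_def prod.If_cases)
  thus ?thesis using assms by (simp add: Int_commute)
qed

text \<open>By symmetry of the characters the summand becomes a product over \<open>T\<close>;
  padded with the factor 1 over \<open>A - T\<close>, the sum over all \<open>T\<close> is the
  expansion of a product over \<open>A\<close>. Its factors are 2 where \<open>U\<close> and
  \<open>V\<close> agree and 0 where they differ.\<close>

lemma walsh_orthogonal:
  assumes A: "finite A" and UV: "U \<subseteq> A" "V \<subseteq> A"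
  shows "(\<Sum>T\<in>Pow A. walsh U T * walsh V T) = (if U = V then 2 ^ card A else 0)"
proof -
  have fin: "finite X" if "X \<subseteq> A" for X using that A finite_subset by blast
  have "(\<Sum>T\<in>Pow A. walsh U T * walsh V T) =
      (\<Sum>T\<in>Pow A. (\<Prod>i\<in>T. walsh {i} U * walsh {i} V) * (\<Prod>i\<in>A - T. 1))"
  proof (rule sum.cong)
    fix T assume "T \<in> Pow A"
    hence "walsh U T = walsh T U" "walsh V T = walsh T V"
      using fin UV by (auto intro!: walsh_commute)
    thus "walsh U T * walsh V T = (\<Prod>i\<in>T. walsh {i} U * walsh {i} V) * (\<Prod>i\<in>A - T. 1)"
      using walsh_eq_prod[of T] by (simp add: prod.distrib)
  qed simp
  also have "\<dots> = (\<Prod>i\<in>A. walsh {i} U * walsh {i} V + 1)"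
    using A by (simp add: prod_add)
  also have "\<dots> = (if U = V then 2 ^ card A else 0)"
  proof (cases "U = V")
    case False
    then obtain i where "i \<in> A" "i \<in> U \<longleftrightarrow> i \<notin> V"
      using UV by blast
    moreover from this have "walsh {i} U * walsh {i} V + 1 = 0"
      by (auto simp: walsh_singleton)
    ultimately show ?thesis using A False by (auto simp: prod_zero)
  qed simp
  finally show ?thesis .
qed

text \<open>Fourier inversion: weighting the hypotheses by \<open>walsh U S\<close> and summing over
  \<open>U\<close> yields \<open>2 ^ card A * v S\<close>. Orthogonality is used here in the index
  \<open>U\<close>, hence the appeal to \<open>walsh_commute\<close>.\<close>

lemma walsh_complete:
  fixes v :: "'a set \<Rightarrow> real"
  assumes A: "finite A" and S: "S \<subseteq> A"
    and zero: "\<And>U. U \<subseteq> A \<Longrightarrow> (\<Sum>T\<in>Pow A. walsh U T * v T) = 0"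
  shows "v S = 0"
proof -
  have fin: "finite X" if "X \<subseteq> A" for X using that A finite_subset by blast
  have "0 = (\<Sum>U\<in>Pow A. walsh U S * (\<Sum>T\<in>Pow A. walsh U T * v T))"
    using zero by simp
  also have "\<dots> = (\<Sum>T\<in>Pow A. v T * (\<Sum>U\<in>Pow A. walsh U S * walsh U T))"
    by (simp add: sum_distrib_left, subst sum.swap, simp add: algebra_simps)
  also have "\<dots> = (\<Sum>T\<in>Pow A. v T * (if S = T then 2 ^ card A else 0))"
  proof (rule sum.cong)
    fix T assume T: "T \<in> Pow A"
    have "(\<Sum>U\<in>Pow A. walsh U S * walsh U T) = (\<Sum>U\<in>Pow A. walsh S U * walsh T U)"
      using fin S T by (intro sum.cong arg_cong2[of _ _ _ _ "(*)"] walsh_commute) auto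
    thus "v T * (\<Sum>U\<in>Pow A. walsh U S * walsh U T) = v T * (if S = T then 2 ^ card A else 0)"
      using walsh_orthogonal[OF A S, of T] T by simp
  qed simp
  also have "\<dots> = v S * 2 ^ card A"
    using A S by (simp add: if_distrib[of "\<lambda>x. _ * x"] cong: if_cong)
  finally show ?thesis by simp
qed

section \<open>Walsh expansion of the matrix entries\<close>

text \<open>\<open>walsh1\<close> and \<open>walsh2\<close> are the elementary symmetric polynomials
  \<open>e1\<close> and \<open>e2\<close> of the sign vector.\<close>

definition walsh1 :: "'a set \<Rightarrow> 'a set \<Rightarrow> real" where
  "walsh1 A S = (\<Sum>i\<in>A. walsh {i} S)"

definition walsh2 :: "'a set \<Rightarrow> 'a set \<Rightarrow> real" where
  "walsh2 A S = (\<Sum>W\<in>pairs A. walsh W S)"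

lemma walsh1_square:
  assumes "finite A"
  shows "(walsh1 A S)\<^sup>2 = real (card A) + 2 * walsh2 A S"
proof -
  have "(walsh1 A S)\<^sup>2 = (\<Sum>i\<in>A. (walsh {i} S)\<^sup>2) + 2 * (\<Sum>W\<in>pairs A. \<Prod>i\<in>W. walsh {i} S)"
    unfolding walsh1_def by (rule square_sum_pairs[OF assms])
  thus ?thesis by (simp add: power2_eq_square walsh2_def flip: walsh_eq_prod)
qed

text \<open>The coefficients of the Walsh expansion of \<open>8 * M_entry r S\<close>.\<close>

definition M_coeff :: "nat \<Rightarrow> nat set \<Rightarrow> nat set \<Rightarrow> real" where
  "M_coeff r U S =
    (if U = {} then real (r choose 2) + walsh2 {1..r} S
     else if card U = 1 then (real r - 2) * walsh U S + walsh1 {1..r} S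
     else if card U = 2 then 1 + walsh U S else 0)"

lemma real_choose_2: "real (n choose 2) = (real n * real n - real n) / 2"
proof -
  have "even (n * (n - 1))" by (cases n) simp_all
  hence "real (n choose 2) = real (n * (n - 1)) / 2"
    by (simp add: choose_two real_of_nat_div)
  thus ?thesis by (cases n) (simp_all add: algebra_simps)
qed

lemma card_eq_sum_indicator:
  assumes "finite A" "X \<subseteq> A"
  shows "real (card X) = (\<Sum>i\<in>A. if i \<in> X then 1 else 0)"
  using assms by (simp add: Int_absorb1 flip: sum.inter_restrict)

lemma M_entry_walsh:
  assumes S: "S \<subseteq> {1..r}" and T: "T \<subseteq> {1..r}"
  shows "8 * M_entry r S T = (\<Sum>U\<in>Pow {1..r}. M_coeff r U S * walsh U T)"
proof -
  let ?A = "{1..r}"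
  define x y where "x i = walsh {i} S" and "y i = walsh {i} T" for i
  define g where "g = (\<Sum>i\<in>?A. x i * y i)"
  define h where "h = (\<Sum>W\<in>pairs ?A. walsh W S * walsh W T)"
  let ?p = "walsh1 ?A S" and ?q = "walsh1 ?A T"
  have p: "?p = (\<Sum>i\<in>?A. x i)" and q: "?q = (\<Sum>i\<in>?A. y i)"
    by (simp_all add: walsh1_def x_def y_def)
  have g2: "g\<^sup>2 = real r + 2 * h"
  proof -
    have "g\<^sup>2 = (\<Sum>i\<in>?A. (x i * y i)\<^sup>2) + 2 * (\<Sum>W\<in>pairs ?A. \<Prod>i\<in>W. x i * y i)"
      unfolding g_def by (rule square_sum_pairs) simp
    moreover have "(x i * y i)\<^sup>2 = 1" for i
      by (simp add: x_def y_def walsh_singleton)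
    ultimately show ?thesis
      by (simp add: h_def prod.distrib x_def y_def flip: walsh_eq_prod)
  qed
  \<comment> \<open>A sign is -1 on members, so the indicator of \<open>S \<inter> T\<close> at
    \<open>i\<close> is \<open>(1 - x i) * (1 - y i) / 4\<close>; for the complements both signs
    flip.\<close>
  have in1: "real (card (S \<inter> T)) = (real r - ?p - ?q + g) / 4"
  proof -
    have "real (card (S \<inter> T)) = (\<Sum>i\<in>?A. if i \<in> S \<inter> T then 1 else 0)"
      using S by (intro card_eq_sum_indicator) auto
    also have "\<dots> = (\<Sum>i\<in>?A. (1 - x i - y i + x i * y i) / 4)"
      by (intro sum.cong) (auto simp: x_def y_def walsh_singleton)
    also have "\<dots> = (real r - ?p - ?q + g) / 4"
      by (simp add: p q g_def sum.distrib sum_subtractf flip: sum_divide_distrib)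
    finally show ?thesis .
  qed
  have in2: "real (card ((?A - S) \<inter> (?A - T))) = (real r + ?p + ?q + g) / 4"
  proof -
    have "real (card ((?A - S) \<inter> (?A - T))) = (\<Sum>i\<in>?A. if i \<in> (?A - S) \<inter> (?A - T) then 1 else 0)"
      by (intro card_eq_sum_indicator) auto
    also have "\<dots> = (\<Sum>i\<in>?A. (1 + x i + y i + x i * y i) / 4)"
      by (intro sum.cong) (auto simp: x_def y_def walsh_singleton)
    also have "\<dots> = (real r + ?p + ?q + g) / 4"
      by (simp add: p q g_def sum.distrib flip: sum_divide_distrib)
    finally show ?thesis .
  qed
  \<comment> \<open>The two cardinalities differ only in the sign of \<open>?p + ?q\<close>, so the
    cross terms cancel.\<close>
  have "8 * M_entry r S T = ((real r + g)\<^sup>2 + (?p + ?q)\<^sup>2) / 2 - 2 * (real r + g)"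
    unfolding M_entry_def real_choose_2 in1 in2 by (simp add: power2_eq_square field_simps)
  \<comment> \<open>The squares of \<open>g\<close>, \<open>?p\<close> and \<open>?q\<close> are
    replaced by degree 2 sums.\<close>
  also have "\<dots> = real (r choose 2) + walsh2 ?A S + walsh2 ?A T + h + (real r - 2) * g + ?p * ?q"
    using g2 walsh1_square[of ?A S] walsh1_square[of ?A T]
    by (simp add: real_choose_2 power2_eq_square field_simps)
  also have "\<dots> = (\<Sum>U\<in>Pow ?A. M_coeff r U S * walsh U T)"
  proof -
    have "(\<Sum>U\<in>Pow ?A. M_coeff r U S * walsh U T) = real (r choose 2) + walsh2 ?A S
        + (\<Sum>i\<in>?A. ((real r - 2) * x i + ?p) * y i)
        + (\<Sum>W\<in>pairs ?A. (1 + walsh W S) * walsh W T)"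
      by (subst sum_Pow_card_le_2)
        (auto simp: M_coeff_def x_def y_def pairs_def intro!: sum.cong)
    thus ?thesis
      by (simp add: g_def h_def q walsh2_def distrib_right sum.distrib sum_distrib_left mult.assoc)
  qed
  finally show ?thesis .
qed

text \<open>By symmetry of \<open>M_entry\<close>, the Walsh expansion can be taken in the summation
  variable \<open>T\<close>. Orthogonality then extracts the coefficient at \<open>U\<close>, and
  \<open>2 ^ r / 8\<close> gives the scalar.\<close>

lemma M_entry_apply_walsh:
  assumes r: "r \<ge> 3" and S: "S \<subseteq> {1..r}" and U: "U \<subseteq> {1..r}"
  shows "(\<Sum>T\<in>Pow {1..r}. walsh U T * M_entry r T S) = 2 ^ (r - 3) * M_coeff r U S"
proof -
  let ?A = "{1..r}"
  have "8 * (\<Sum>T\<in>Pow ?A. walsh U T * M_entry r T S)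
      = (\<Sum>T\<in>Pow ?A. walsh U T * (8 * M_entry r S T))"
    by (simp add: sum_distrib_left M_entry_def Int_commute mult_ac)
  also have "\<dots> = (\<Sum>T\<in>Pow ?A. \<Sum>V\<in>Pow ?A. M_coeff r V S * (walsh U T * walsh V T))"
    using M_entry_walsh[OF S] by (intro sum.cong) (simp_all add: sum_distrib_left mult.left_commute)
  also have "\<dots> = (\<Sum>V\<in>Pow ?A. M_coeff r V S * (\<Sum>T\<in>Pow ?A. walsh U T * walsh V T))"
    by (subst sum.swap) (simp add: sum_distrib_left)
  also have "\<dots> = (\<Sum>V\<in>Pow ?A. M_coeff r V S * (if U = V then 2 ^ r else 0))"
    using U by (intro sum.cong) (auto simp: walsh_orthogonal)
  also have "\<dots> = 2 ^ r * M_coeff r U S"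
    using U by (simp add: if_distrib[of "\<lambda>x. _ * x"] cong: if_cong)
  also have "(2 :: real) ^ r = 8 * 2 ^ (r - 3)"
    using r power_add[of "2 :: real" 3 "r - 3"] by simp
  finally show ?thesis by simp
qed

section \<open>Eigenvectors, eigenvalues and completeness of the eigenbasis\<close>

text \<open>
  The sets \<open>{1}\<close> and \<open>{1, 2}\<close> are base points: they label the symmetric eigenvectors, and the other
  sets of the same size label differences with the base character.
\<close>

definition M_eigvec :: "nat \<Rightarrow> nat set \<Rightarrow> nat set \<Rightarrow> real" where
  "M_eigvec r U S =
    (if U = {} then 1 - walsh2 {1..r} S
     else if U = {1} then walsh1 {1..r} S
     else if card U = 1 then walsh U S - walsh {1} S
     else if U = {1, 2} then real (r choose 2) + walsh2 {1..r} S
     else if card U = 2 then walsh U S - walsh {1, 2} S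
     else walsh U S)"

text \<open>The empty set falls into the last branch: its vector \<open>1 - e2\<close> lies in the
  kernel, as do the characters of degree at least 3.\<close>

definition M_eigval :: "nat \<Rightarrow> nat set \<Rightarrow> real" where
  "M_eigval r U = 2 ^ (r - 3) *
    (if U = {1} then 2 * (real r - 1)
     else if card U = 1 then real r - 2
     else if U = {1, 2} then real (r choose 2) + 1
     else if card U = 2 then 1
     else 0)"

text \<open>With \<open>S\<close> fixed, the sum is a linear functional \<open>L\<close> of the
  vector, known on characters. In a difference of characters of equal degree 1 or 2, the part of
  \<open>M_coeff\<close> that does not depend on the individual character cancels.\<close>

lemma M_eigvec_eq:
  assumes r: "r \<ge> 3" and S: "S \<subseteq> {1..r}" and U: "U \<subseteq> {1..r}"
  shows "(\<Sum>T\<in>Pow {1..r}. M_eigvec r U T * M_entry r T S) = M_eigval r U * M_eigvec r U S"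
proof -
  let ?A = "{1..r}"
  define L where "L f = (\<Sum>T\<in>Pow ?A. f T * M_entry r T S)" for f
  have L_walsh: "L (walsh V) = 2 ^ (r - 3) * M_coeff r V S" if "V \<subseteq> ?A" for V
    unfolding L_def using M_entry_apply_walsh[OF r S that] .
  have L_diff: "L (\<lambda>T. f T - g T) = L f - L g" for f g
    by (simp add: L_def sum_subtractf left_diff_distrib)
  have L_add: "L (\<lambda>T. f T + g T) = L f + L g" for f g
    by (simp add: L_def sum.distrib distrib_right)
  have L_const: "L (\<lambda>T. c) = c * (2 ^ (r - 3) * (real (r choose 2) + walsh2 ?A S))" for c
  proof -
    have "L (\<lambda>T. c) = c * L (walsh {})"
      by (simp add: L_def sum_distrib_left)
    thus ?thesis using L_walsh[of "{}"] by (simp add: M_coeff_def)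
  qed
  have L1: "L (walsh1 ?A) = 2 ^ (r - 3) * (2 * (real r - 1)) * walsh1 ?A S"
  proof -
    have "L (walsh1 ?A) = (\<Sum>i\<in>?A. L (walsh {i}))"
      unfolding L_def walsh1_def sum_distrib_right by (rule sum.swap)
    also have "\<dots> = (\<Sum>i\<in>?A. 2 ^ (r - 3) * ((real r - 2) * walsh {i} S + walsh1 ?A S))"
      by (intro sum.cong) (auto simp: L_walsh M_coeff_def)
    also have "\<dots> = 2 ^ (r - 3) * ((real r - 2) * walsh1 ?A S + real r * walsh1 ?A S)"
      by (simp add: sum.distrib walsh1_def flip: sum_distrib_left)
    finally show ?thesis by (simp add: algebra_simps)
  qed
  \<comment> \<open>This equals the image of the constant 1, which is why \<open>1 - e2\<close> is
    annihilated and \<open>N + e2\<close> is scaled by \<open>N + 1\<close>.\<close>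
  have L2: "L (walsh2 ?A) = 2 ^ (r - 3) * (real (r choose 2) + walsh2 ?A S)"
  proof -
    have "L (walsh2 ?A) = (\<Sum>W\<in>pairs ?A. L (walsh W))"
      unfolding L_def walsh2_def sum_distrib_right by (rule sum.swap)
    also have "\<dots> = (\<Sum>W\<in>pairs ?A. 2 ^ (r - 3) * (1 + walsh W S))"
      by (intro sum.cong) (auto simp: L_walsh M_coeff_def pairs_def)
    also have "\<dots> = 2 ^ (r - 3) * (real (r choose 2) + walsh2 ?A S)"
      by (simp add: sum.distrib walsh2_def card_pairs flip: sum_distrib_left)
    finally show ?thesis .
  qed
  have "L (M_eigvec r U) = M_eigval r U * M_eigvec r U S"
  proof -
    consider "U = {}" | "U = {1}" | "U \<noteq> {1}" "card U = 1" | "U = {1, 2}"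
      | "U \<noteq> {1, 2}" "card U = 2" | "card U > 2"
      using U finite_subset[OF U] card_0_eq[of U] by fastforce
    thus ?thesis
    proof cases
      case 1
      thus ?thesis
        by (simp add: M_eigvec_def[abs_def] M_eigval_def L_diff L_const L2)
    next
      case 2
      thus ?thesis
        by (simp add: M_eigvec_def[abs_def] M_eigval_def L1)
    next
      case 3
      hence "U \<noteq> {}" by auto
      have "L (walsh U) - L (walsh {1}) = 2 ^ (r - 3) * (real r - 2) * (walsh U S - walsh {1} S)"
        using 3 r U \<open>U \<noteq> {}\<close> by (subst (1 2) L_walsh) (auto simp: M_coeff_def algebra_simps)
      thus ?thesis
        using 3 \<open>U \<noteq> {}\<close> by (simp add: M_eigvec_def[abs_def] M_eigval_def L_diff)
    next
      case 4
      thus ?thesis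
        by (simp add: M_eigvec_def[abs_def] M_eigval_def L_add L_const L2 algebra_simps)
    next
      case 5
      hence "U \<noteq> {}" "U \<noteq> {1}" by auto
      have "L (walsh U) - L (walsh {1, 2}) = 2 ^ (r - 3) * (walsh U S - walsh {1, 2} S)"
        using 5 r U \<open>U \<noteq> {}\<close> by (subst (1 2) L_walsh) (auto simp: M_coeff_def algebra_simps)
      thus ?thesis
        using 5 \<open>U \<noteq> {}\<close> \<open>U \<noteq> {1}\<close> by (simp add: M_eigvec_def[abs_def] M_eigval_def L_diff)
    next
      case 6
      hence "U \<noteq> {}" "U \<noteq> {1}" "U \<noteq> {1, 2}" by auto
      thus ?thesis
        using 6 U L_walsh[OF U] by (simp add: M_eigvec_def[abs_def] M_eigval_def M_coeff_def)
    qed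
  qed
  thus ?thesis by (simp add: L_def)
qed

text \<open>If \<open>v\<close> is orthogonal to all the eigenvectors, it is orthogonal to every
  Walsh character, and \<open>walsh_complete\<close> applies. The characters are recovered degree by
  degree; degrees 0 and 2 are coupled.\<close>

lemma M_eigvec_complete:
  assumes r: "r \<ge> 2" and S: "S \<subseteq> {1..r}"
    and zero: "\<And>U. U \<subseteq> {1..r} \<Longrightarrow> (\<Sum>T\<in>Pow {1..r}. M_eigvec r U T * v T) = 0"
  shows "v S = 0"
proof (rule walsh_complete[of "{1..r}"])
  let ?A = "{1..r}"
  define L where "L f = (\<Sum>T\<in>Pow ?A. f T * v T)" for f
  have L0: "L (M_eigvec r U) = 0" if "U \<subseteq> ?A" for U
    using zero[OF that] by (simp add: L_def)
  have L_diff: "L (\<lambda>T. f T - g T) = L f - L g" for f g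
    by (simp add: L_def sum_subtractf left_diff_distrib)
  have L_add: "L (\<lambda>T. f T + g T) = L f + L g" for f g
    by (simp add: L_def sum.distrib distrib_right)
  have L_const: "L (\<lambda>T. c) = c * L (walsh {})" for c
    by (simp add: L_def sum_distrib_left)
  have N: "real (r choose 2) > 0" using r by (simp add: zero_less_binomial)
  have L1: "L (walsh1 ?A) = (\<Sum>i\<in>?A. L (walsh {i}))"
    unfolding L_def walsh1_def sum_distrib_right by (rule sum.swap)
  have L2: "L (walsh2 ?A) = (\<Sum>W\<in>pairs ?A. L (walsh W))"
    unfolding L_def walsh2_def sum_distrib_right by (rule sum.swap)
  have single_eq: "L (walsh {i}) = L (walsh {1})" if "i \<in> ?A" for i
    using L0[of "{i}"] that
    by (cases "i = 1") (auto simp: M_eigvec_def[abs_def] L_diff)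
  \<comment> \<open>The differences make all degree 1 values equal, and their sum vanishes.\<close>
  have single: "L (walsh {i}) = 0" if "i \<in> ?A" for i
  proof -
    have "0 = L (walsh1 ?A)" using L0[of "{1}"] r by (simp add: M_eigvec_def[abs_def])
    also have "\<dots> = (\<Sum>i\<in>?A. L (walsh {1}))" unfolding L1 by (intro sum.cong refl) (rule single_eq)
    finally show ?thesis using r single_eq[OF that] by simp
  qed
  have pair_eq: "L (walsh W) = L (walsh {1, 2})" if "W \<in> pairs ?A" for W
  proof (cases "W = {1, 2}")
    case False
    moreover have "card W = 2" "W \<noteq> {}" "W \<noteq> {1}" "W \<subseteq> ?A"
      using that by (auto simp: pairs_def)
    ultimately show ?thesis
      using L0[of W] by (simp add: M_eigvec_def[abs_def] L_diff)
  qed simp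
  have L2': "L (walsh2 ?A) = real (r choose 2) * L (walsh {1, 2})"
  proof -
    have "L (walsh2 ?A) = (\<Sum>W\<in>pairs ?A. L (walsh {1, 2}))"
      unfolding L2 by (intro sum.cong refl) (rule pair_eq)
    thus ?thesis by (simp add: card_pairs)
  qed
  \<comment> \<open>Two linear equations in \<open>L (walsh {})\<close> and
    \<open>L (walsh {1, 2})\<close>, with determinant \<open>N + N^2 > 0\<close> for
    \<open>N = r choose 2\<close>; adding them isolates the first unknown.\<close>
  have e1: "L (walsh {}) - real (r choose 2) * L (walsh {1, 2}) = 0"
    using L0[of "{}"] L_const[of 1] by (simp add: M_eigvec_def[abs_def] L_diff L2')
  have e2: "real (r choose 2) * L (walsh {}) + real (r choose 2) * L (walsh {1, 2}) = 0"
    using L0[of "{1, 2}"] L_const[of "real (r choose 2)"] r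
    by (simp add: M_eigvec_def[abs_def] L_add L2')
  have "(real (r choose 2) + 1) * L (walsh {}) = 0"
    using e1 e2 by (simp add: algebra_simps)
  hence empty: "L (walsh {}) = 0" using N by simp
  hence "L (walsh {1, 2}) = 0" using e1 N by simp
  hence pair: "L (walsh W) = 0" if "W \<in> pairs ?A" for W using pair_eq[OF that] by simp
  fix U assume U: "U \<subseteq> ?A"
  consider "U = {}" | i where "U = {i}" | "U \<in> pairs ?A" | "card U > 2"
    using U finite_subset[OF U] card_0_eq[of U] card_1_singleton_iff[of U]
    by (fastforce simp: pairs_def)
  hence "L (walsh U) = 0"
  proof cases
    case 4
    hence "U \<noteq> {}" "U \<noteq> {1}" "U \<noteq> {1, 2}" by auto
    thus ?thesis using 4 L0[OF U] by (simp add: M_eigvec_def[abs_def])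
  qed (use empty single pair U in auto)
  thus "(\<Sum>T\<in>Pow ?A. walsh U T * v T) = 0" by (simp add: L_def)
qed (use S in auto)

section \<open>Characteristic polynomial, spectrum and multiplicities\<close>

text \<open>Reindexing along \<open>e\<close> turns matrix products into sums over
  \<open>Pow {1..r}\<close>; the resulting product no longer mentions the enumeration.\<close>

lemma char_poly_M_mat:
  assumes r: "r \<ge> 3" and e: "bij_betw e {0..<2 ^ r} (Pow {1..r})"
  shows "char_poly (M_mat r e) = (\<Prod>U\<in>Pow {1..r}. [:- M_eigval r U, 1:])"
proof -
  let ?n = "2 ^ r :: nat" and ?A = "{1..r}"
  define B where "B = mat ?n ?n (\<lambda>(i, j). M_eigvec r (e i) (e j))"
  have B: "B \<in> carrier_mat ?n ?n" by (simp add: B_def)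
  have M: "M_mat r e \<in> carrier_mat ?n ?n" by (simp add: M_mat_def)
  have sub: "e i \<subseteq> ?A" if "i < ?n" for i
    using bij_betwE[OF e] that by force
  have reindex: "(\<Sum>k = 0..<?n. f (e k)) = (\<Sum>T\<in>Pow ?A. f T)" for f :: "nat set \<Rightarrow> real"
    by (rule sum.reindex_bij_betw[OF e])
  have "char_poly (M_mat r e) = (\<Prod>i<?n. [:- M_eigval r (e i), 1:])"
  proof (rule char_poly_diagonalized[OF M B])
    fix i j assume ij: "i < ?n" "j < ?n"
    have "(B * M_mat r e) $$ (i, j) = (\<Sum>k = 0..<?n. M_eigvec r (e i) (e k) * M_entry r (e k) (e j))"
      using ij by (simp add: B_def M_mat_def scalar_prod_def)
    also have "\<dots> = M_eigval r (e i) * M_eigvec r (e i) (e j)"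
      using reindex[of "\<lambda>T. M_eigvec r (e i) T * M_entry r T (e j)"]
        M_eigvec_eq[OF r sub[OF ij(2)] sub[OF ij(1)]] by simp
    finally show "(B * M_mat r e) $$ (i, j) = M_eigval r (e i) * B $$ (i, j)"
      using ij by (simp add: B_def)
  next
    fix v :: "real vec" assume v: "v \<in> carrier_vec ?n" and 0: "B *\<^sub>v v = 0\<^sub>v ?n"
    \<comment> \<open>The vector \<open>v\<close> read as a function on subsets, the form in which
      completeness is available.\<close>
    define w where "w T = v $ (inv_into {0..<?n} e T)" for T
    have w: "w (e k) = v $ k" if "k < ?n" for k
      using that bij_betw_imp_inj_on[OF e] by (simp add: w_def inv_into_f_f)
    have "w T = 0" if "T \<subseteq> ?A" for T
    proof (rule M_eigvec_complete[OF _ that])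
      fix U assume "U \<subseteq> ?A"
      hence "U \<in> e ` {0..<?n}" using bij_betw_imp_surj_on[OF e] by simp
      then obtain i where i: "i < ?n" "U = e i" by auto
      have "(\<Sum>T\<in>Pow ?A. M_eigvec r U T * w T) = (\<Sum>k = 0..<?n. M_eigvec r U (e k) * w (e k))"
        by (rule reindex[of "\<lambda>T. M_eigvec r U T * w T", symmetric])
      also have "\<dots> = (B *\<^sub>v v) $ i"
        using i v w by (simp add: B_def scalar_prod_def)
      finally show "(\<Sum>T\<in>Pow ?A. M_eigvec r U T * w T) = 0" using 0 i by simp
    qed (use r in simp)
    hence "v $ k = 0" if "k < ?n" for k using w[OF that] sub[OF that] by simp
    thus "v = 0\<^sub>v ?n" using v by (intro eq_vecI) auto
  qed
  thus ?thesis
    using prod.reindex_bij_betw[OF e, of "\<lambda>U. [:- M_eigval r U, 1:]"]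
    by (simp add: lessThan_atLeast0)
qed

theorem theorem1:
  fixes r :: nat and e :: "nat \<Rightarrow> nat set"
  assumes "r \<ge> 4"
    and "bij_betw e {0..<2 ^ r} (Pow {1..r})"
  shows "spectrum (M_mat r e) =
      {0, 2 ^ (r - 3) * (real r - 2), 2 ^ (r - 3),
       2 ^ (r - 4) * ((real r)\<^sup>2 - real r + 2), 2 ^ (r - 2) * (real r - 1)}
    \<and> eigenvalue_mult (M_mat r e) 0 = 2 ^ r - ((r + 1) choose 2)
    \<and> eigenvalue_mult (M_mat r e) (2 ^ (r - 3) * (real r - 2)) = r - 1
    \<and> eigenvalue_mult (M_mat r e) (2 ^ (r - 3)) = (r choose 2) - 1
    \<and> eigenvalue_mult (M_mat r e) (2 ^ (r - 4) * ((real r)\<^sup>2 - real r + 2)) = 1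
    \<and> eigenvalue_mult (M_mat r e) (2 ^ (r - 2) * (real r - 1)) = 1"
proof -
  let ?A = "{1..r}" and ?d = "M_eigval r"
  define c1 c2 c3 c4 where "c1 = (2 :: real) ^ (r - 3) * (real r - 2)"
    and "c2 = (2 :: real) ^ (r - 3)"
    and "c3 = 2 ^ (r - 4) * ((real r)\<^sup>2 - real r + 2)"
    and "c4 = 2 ^ (r - 2) * (real r - 1)"
  have M: "M_mat r e \<in> carrier_mat (2 ^ r) (2 ^ r)" by (simp add: M_mat_def)
  have cp: "char_poly (M_mat r e) = (\<Prod>U\<in>Pow ?A. [:- ?d U, 1:])"
    using assms by (intro char_poly_M_mat) auto
  have mult: "eigenvalue_mult (M_mat r e) c = card {U \<in> Pow ?A. ?d U = c}" for c
    unfolding eigenvalue_mult_def cp by (rule order_prod_linear) simp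
  have spec: "spectrum (M_mat r e) = ?d ` Pow ?A"
  proof -
    have "spectrum (M_mat r e) = {c. poly (char_poly (M_mat r e)) c = 0}"
      unfolding spectrum_def using eigenvalue_root_char_poly[OF M] by auto
    also have "\<dots> = ?d ` Pow ?A"
      unfolding cp by (auto simp: poly_prod)
    finally show ?thesis .
  qed
  \<comment> \<open>All eigenvalues are put over the common power \<open>2 ^ (r - 4)\<close>; the
    extra factor 2 clears the denominator of \<open>(r choose 2) + 1\<close>.\<close>
  have "r - 3 = (r - 4) + 1" "r - 2 = (r - 4) + 2" using assms(1) by auto
  hence p3: "(2 :: real) ^ (r - 3) = 2 * 2 ^ (r - 4)" and p2: "(2 :: real) ^ (r - 2) = 4 * 2 ^ (r - 4)"
    by (simp_all only: power_add) simp_all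
  have d: "?d U = (if U = {1} then c4 else if card U = 1 then c1
      else if U = {1, 2} then c3 else if card U = 2 then c2 else 0)" for U
    by (simp add: M_eigval_def c1_def c2_def c3_def c4_def p3 p2 real_choose_2 power2_eq_square
        field_simps)
  \<comment> \<open>The term \<open>4 * (real r - 1)\<close> belongs to \<open>c4\<close>, so the
    positive remainder \<open>(r - 2) (r - 3)\<close> separates \<open>c3\<close> from
    \<open>c4\<close>.\<close>
  have quad: "(real r)\<^sup>2 - real r + 2 = (real r - 2) * (real r - 3) + 4 * (real r - 1)"
    by (simp add: power2_eq_square algebra_simps)
  have prod: "(real r - 2) * (real r - 3) > 0"
    using assms(1) by (auto intro!: mult_pos_pos)
  have pos: "(2 :: real) ^ (r - 4) > 0" by simp
  \<comment> \<open>Strict order makes the five values distinct, so each fibre of \<open>?d\<close>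
    is a single class of labels. The bound on \<open>r\<close> enters in \<open>c2 < c1\<close>,
    which amounts to \<open>r - 2 > 1\<close>.\<close>
  have order: "0 < c2" "c2 < c1" "c1 < c4" "c4 < c3"
  proof -
    show "0 < c2" by (simp add: c2_def)
    show "c2 < c1" using assms(1) by (simp add: c1_def c2_def)
    show "c1 < c4" using assms(1) pos by (simp add: c1_def c4_def p3 p2)
    show "c4 < c3" unfolding c3_def c4_def p2 mult.assoc mult.left_commute[of 4]
      using prod quad by (intro mult_strict_left_mono) auto
  qed
  have "{1, 2} \<in> pairs ?A" using assms(1) by (auto simp: pairs_def)
  have card12: "card {1, 2 :: nat} = 2" by simp
  let ?S = "{U. U \<subseteq> ?A \<and> card U = 1}"
  have cS: "card ?S = r" using n_subsets[of ?A 1] by (simp add: One_nat_def)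
  have cP: "card (pairs ?A) = r choose 2" by (simp add: card_pairs)
  have k4: "{U \<in> Pow ?A. ?d U = c4} = {{1}}"
    using order assms(1) by (auto simp: d split: if_splits)
  have k3: "{U \<in> Pow ?A. ?d U = c3} = {{1, 2}}"
    using order assms(1) card12 by (auto simp: d split: if_splits)
  have k2: "{U \<in> Pow ?A. ?d U = c2} = pairs ?A - {{1, 2}}"
    using order assms(1) by (auto simp: d pairs_def split: if_splits)
  have k1: "{U \<in> Pow ?A. ?d U = c1} = ?S - {{1}}"
    using order assms(1) by (auto simp: d split: if_splits)
  have k0: "{U \<in> Pow ?A. ?d U = 0} = Pow ?A - (?S \<union> pairs ?A)"
    using order assms(1) by (auto simp: d pairs_def split: if_splits)
  have m0: "card {U \<in> Pow ?A. ?d U = 0} = 2 ^ r - ((r + 1) choose 2)"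
  proof -
    have "card (?S \<union> pairs ?A) = r + (r choose 2)"
      using cS cP by (subst card_Un_disjoint) (auto simp: pairs_def)
    \<comment> \<open>Pascal's rule: the labels of nonzero eigenvalues are the subsets of size 1 or
      2.\<close>
    moreover have "(r + 1) choose 2 = r + (r choose 2)"
      by (simp add: numeral_2_eq_2 One_nat_def)
    ultimately show ?thesis
      unfolding k0 by (subst card_Diff_subset) (auto simp: pairs_def card_Pow)
  qed
  have m1: "card {U \<in> Pow ?A. ?d U = c1} = r - 1"
    unfolding k1 using cS assms(1) by (subst card_Diff_singleton) auto
  have m2: "card {U \<in> Pow ?A. ?d U = c2} = (r choose 2) - 1"
    unfolding k2 using cP \<open>{1, 2} \<in> pairs ?A\<close> by (subst card_Diff_singleton) auto
  have "?d ` Pow ?A = {0, c1, c2, c3, c4}"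
  proof (intro equalityI subsetI)
    fix c assume "c \<in> {0, c1, c2, c3, c4}"
    \<comment> \<open>One label per eigenvalue; \<open>{2}\<close> and \<open>{1, 3}\<close> are
      sets of size 1 and 2 other than the base points.\<close>
    moreover have "?d {} = 0" "?d {2} = c1" "?d {1, 3} = c2" "?d {1, 2} = c3" "?d {1} = c4"
      by (auto simp: d doubleton_eq_iff)
    moreover have "{} \<in> Pow ?A" "{2} \<in> Pow ?A" "{1, 3} \<in> Pow ?A" "{1, 2} \<in> Pow ?A" "{1} \<in> Pow ?A"
      using assms(1) by auto
    ultimately show "c \<in> ?d ` Pow ?A"
      by (metis image_eqI insertE singletonD)
  qed (auto simp: d split: if_splits)
  thus ?thesis
    using m0 m1 m2 unfolding c1_def[symmetric] c3_def[symmetric] c4_def[symmetric]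
    unfolding c2_def[symmetric] mult spec k3 k4 by simp
qed

end
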